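(* For all $f,g,h,j\in\mathcal H$ one has $$\widehat{f\star_{\mathcal U}g}=\widehat f\,\widehat g,\qquad \widehat{(h\star_{\mathcal V}j)}_{\ast}=\widehat h_{\ast}\,\widehat j_{\ast}$$ (pointwise products of functions on $I$). Therefore the convolutions $\star_{\mathcal U}$ and $\star_{\mathcal V}$ on $\mathcal H$ are commutative and associative. Moreover, let $K:\mathcal H\times\mathcal H\to\mathcal H$ be a bilinear mapping. If $\widehat{K(f,g)}=\widehat f\,\widehat g$ for all $f,g\in\mathcal H$, then $K$ is the $\mathcal U$-convolution, i.e. $K(f,g)=f\star_{\mathcal U}g$ for all $f,g\in\mathcal H$. Similarly, if $\widehat{K(f,g)}_{\ast}=\widehat f_{\ast}\,\widehat g_{\ast}$ for all $f,g\in\mathcal H$, then $K$ is the $\mathcal V$-convolution, i.e. $K(f,g)=f\star_{\mathcal V}g$ for all $f,g\in\mathcal H$.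
   Context: $\mathcal H$ is a separable complex Hilbert space with inner product $(\cdot,\cdot)$, linear in the first argument. $I$ is a discrete (countable) index set. $\mathcal U=\{u_\xi\}_{\xi\in I}$ is a Riesz basis of $\mathcal H$, and $\mathcal V=\{v_\xi\}_{\xi\in I}\subset\mathcal H$ is the system biorthogonal to $\mathcal U$: $(u_\xi,v_\eta)=\delta_{\xi\eta}$; then $\mathcal V$ is also a Riesz basis of $\mathcal H$. For $f\in\mathcal H$ the $\mathcal U$-Fourier transform is $\widehat f(\xi):=(f,v_\xi)$ and the $\mathcal V$-Fourier transform is $\widehat f_{\ast}(\xi):=(f,u_\xi)$, $\xi\in I$. For $f,g\in\mathcal H$ the convolutions are the (convergent in $\mathcal H$) series $$f\star_{\mathcal U}g:=\sum_{\xi\in I}(f,v_\xi)(g,v_\xi)u_\xi,\qquad f\star_{\mathcal V}g:=\sum_{\xi\in I}(f,u_\xi)(g,u_\xi)v_\xi .$$ *)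

theory Defs
  imports "HOL-Analysis.Analysis"
begin

class complex_vector = real_vector +
  fixes scaleC :: "complex \<Rightarrow> 'a \<Rightarrow> 'a"  (infixr \<open>*\<^sub>C\<close> 75)
  assumes scaleC_add_right: "a *\<^sub>C (x + y) = a *\<^sub>C x + a *\<^sub>C y"
    and scaleC_add_left: "(a + b) *\<^sub>C x = a *\<^sub>C x + b *\<^sub>C x"
    and scaleC_scaleC: "a *\<^sub>C (b *\<^sub>C x) = (a * b) *\<^sub>C x"
    and scaleC_one: "1 *\<^sub>C x = x"
    and scaleR_scaleC: "r *\<^sub>R x = complex_of_real r *\<^sub>C x"

text \<open>The inner product is linear in the first argument. The axiom \<open>cinner_self\<close> says that the norm is
  the one induced by the inner product; together with the norm axioms it contains positive
  definiteness.\<close>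

class complex_inner = real_normed_vector + complex_vector +
  fixes cinner :: "'a \<Rightarrow> 'a \<Rightarrow> complex"
  assumes cinner_add_left: "cinner (x + y) z = cinner x z + cinner y z"
    and cinner_scaleC_left: "cinner (a *\<^sub>C x) y = a * cinner x y"
    and cinner_commute: "cinner x y = cnj (cinner y x)"
    and cinner_self: "cinner x x = complex_of_real ((norm x)\<^sup>2)"

class complex_hilbert = complex_inner + complete_space

abbreviation clinear :: "('a::complex_vector \<Rightarrow> 'b::complex_vector) \<Rightarrow> bool"
  where "clinear \<equiv> Vector_Spaces.linear scaleC scaleC"

abbreviation cspan :: "'a::complex_vector set \<Rightarrow> 'a set"
  where "cspan \<equiv> module.span scaleC"

definition cbilinear :: "('a::complex_vector \<Rightarrow> 'b::complex_vector \<Rightarrow> 'c::complex_vector) \<Rightarrow> bool"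
  where "cbilinear K \<longleftrightarrow> (\<forall>f. clinear (\<lambda>g. K f g)) \<and> (\<forall>g. clinear (\<lambda>f. K f g))"

definition bounded_clinear :: "('a::complex_inner \<Rightarrow> 'b::complex_inner) \<Rightarrow> bool"
  where "bounded_clinear T \<longleftrightarrow> clinear T \<and> (\<exists>C. \<forall>x. norm (T x) \<le> C * norm x)"

text \<open>Systems indexed by a set \<open>I\<close> are functions on the ambient type \<open>'i\<close>; only their values on \<open>I\<close>
  are relevant.\<close>

definition biorthogonal :: "'i set \<Rightarrow> ('i \<Rightarrow> 'a::complex_inner) \<Rightarrow> ('i \<Rightarrow> 'a) \<Rightarrow> bool"
  where "biorthogonal I u v \<longleftrightarrow>
    (\<forall>\<xi>\<in>I. \<forall>\<eta>\<in>I. cinner (u \<xi>) (v \<eta>) = (if \<xi> = \<eta> then 1 else 0))"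

definition orthonormal_basis :: "'i set \<Rightarrow> ('i \<Rightarrow> 'a::complex_inner) \<Rightarrow> bool"
  where "orthonormal_basis I e \<longleftrightarrow> biorthogonal I e e \<and> closure (cspan (e ` I)) = UNIV"

text \<open>A Riesz basis is the image of an orthonormal basis under a bounded linear operator with bounded
  inverse.\<close>

definition riesz_basis :: "'i set \<Rightarrow> ('i \<Rightarrow> 'a::complex_hilbert) \<Rightarrow> bool"
  where "riesz_basis I u \<longleftrightarrow>
    (\<exists>(e :: 'i \<Rightarrow> 'a) (T :: 'a \<Rightarrow> 'a). orthonormal_basis I e \<and>
       bounded_clinear T \<and> bij T \<and> bounded_clinear (inv T) \<and> (\<forall>\<xi>\<in>I. u \<xi> = T (e \<xi>)))"

text \<open>For a Riesz basis \<open>u\<close> with biorthogonal system \<open>v\<close>, the \<open>u\<close>-Fourier transform is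
  \<open>fourier_transform v\<close> and the \<open>v\<close>-Fourier transform is \<open>fourier_transform u\<close>. Likewise the
  \<open>u\<close>-convolution is \<open>convolution I u v\<close> and the \<open>v\<close>-convolution is \<open>convolution I v u\<close>.\<close>

definition fourier_transform :: "('i \<Rightarrow> 'a::complex_inner) \<Rightarrow> 'a \<Rightarrow> 'i \<Rightarrow> complex"
  where "fourier_transform w f \<xi> = cinner f (w \<xi>)"

definition convolution ::
    "'i set \<Rightarrow> ('i \<Rightarrow> 'a::complex_hilbert) \<Rightarrow> ('i \<Rightarrow> 'a) \<Rightarrow> 'a \<Rightarrow> 'a \<Rightarrow> 'a"
  where "convolution I u v f g = (\<Sum>\<^sub>\<infinity>\<xi>\<in>I. (cinner f (v \<xi>) * cinner g (v \<xi>)) *\<^sub>C u \<xi>)"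

end

theory Submission
  imports Defs
begin

text \<open>If \<open>u = T e\<close> with \<open>e\<close> an orthonormal basis, then \<open>cinner f (v \<xi>) = cinner (inv T f) (e \<xi>)\<close>,
  because both sides are linear and continuous in \<open>f\<close> and agree on the \<open>u \<eta>\<close>, whose span is dense.
  Boundedness of \<open>T\<close> and \<open>inv T\<close> thus gives a Bessel inequality for both \<open>u\<close> and \<open>v\<close>, so both
  convolution series converge absolutely; pairing them term by term with the biorthogonal system gives
  the product formula. Both systems are also complete, i.e. a vector is determined by its transform,
  and everything else can be checked on transforms.\<close>

subclass (in complex_hilbert) banach ..

interpretation scaleC: vector_space scaleC
  by unfold_locales (simp_all add: scaleC_add_right scaleC_add_left scaleC_scaleC scaleC_one)

subsection \<open>Inner products\<close>

lemma cinner_scaleC_right: "cinner x (a *\<^sub>C y) = cnj a * cinner x y"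
  by (metis cinner_commute cinner_scaleC_left complex_cnj_mult)

lemma cinner_add_right: "cinner x (y + z) = cinner x y + cinner x z"
  by (metis cinner_commute cinner_add_left complex_cnj_add)

lemma cinner_zero_left [simp]: "cinner 0 x = 0"
  using cinner_add_left[of 0 0 x] by simp

lemma cinner_zero_right [simp]: "cinner x 0 = 0"
  using cinner_add_right[of x 0 0] by simp

lemma cinner_minus_left: "cinner (- x) y = - cinner x y"
  using cinner_add_left[of x "- x" y] by (simp add: add_eq_0_iff)

lemma cinner_minus_right: "cinner x (- y) = - cinner x y"
  using cinner_add_right[of x y "- y"] by (simp add: add_eq_0_iff)

lemma cinner_diff_left: "cinner (x - y) z = cinner x z - cinner y z"
  using cinner_add_left[of x "- y" z] by (simp add: cinner_minus_left)

lemma cinner_diff_right: "cinner x (y - z) = cinner x y - cinner x z"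
  using cinner_add_right[of x y "- z"] by (simp add: cinner_minus_right)

lemma cinner_sum_left: "cinner (\<Sum>i\<in>F. x i) y = (\<Sum>i\<in>F. cinner (x i) y)"
  by (induction F rule: infinite_finite_induct) (auto simp: cinner_add_left)

lemma cinner_sum_right: "cinner y (\<Sum>i\<in>F. x i) = (\<Sum>i\<in>F. cinner y (x i))"
  by (induction F rule: infinite_finite_induct) (auto simp: cinner_add_right)

lemma cinner_mult_commute: "cinner x y * cinner y x = complex_of_real ((norm (cinner x y))\<^sup>2)"
  by (metis cinner_commute complex_norm_square)

text \<open>Cauchy-Schwarz. The vector \<open>z\<close> is the component of \<open>x\<close>
  orthogonal to \<open>y\<close>, multiplied by the squared norm of \<open>y\<close> to avoid a
  division; its squared norm is nonnegative.\<close>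

lemma norm_cinner_le: "norm (cinner x y) \<le> norm x * norm y"
proof (cases "y = 0")
  case False
  define a where "a = complex_of_real ((norm y)\<^sup>2)"
  define z where "z = a *\<^sub>C x - cinner x y *\<^sub>C y"
  have "cinner z z = a * (a * cinner x x - cinner x y * cinner y x)"
    by (simp add: z_def cinner_diff_left cinner_diff_right cinner_scaleC_left cinner_scaleC_right
        cinner_self[of y] cinner_commute[symmetric, of y x] flip: a_def)
      (simp add: a_def algebra_simps)
  also have "\<dots> = complex_of_real ((norm y)\<^sup>2 * ((norm y)\<^sup>2 * (norm x)\<^sup>2 - (norm (cinner x y))\<^sup>2))"
    by (simp add: a_def cinner_self cinner_mult_commute)
  finally have "(norm z)\<^sup>2 = (norm y)\<^sup>2 * ((norm y)\<^sup>2 * (norm x)\<^sup>2 - (norm (cinner x y))\<^sup>2)"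
    unfolding cinner_self of_real_eq_iff .
  then have "0 \<le> (norm y)\<^sup>2 * ((norm y)\<^sup>2 * (norm x)\<^sup>2 - (norm (cinner x y))\<^sup>2)"
    by (metis zero_le_power2)
  with False have "(norm (cinner x y))\<^sup>2 \<le> (norm x * norm y)\<^sup>2"
    by (simp add: zero_le_mult_iff power_mult_distrib mult.commute)
  then show ?thesis
    by (rule power2_le_imp_le) simp
qed simp

text \<open>The norm axioms give homogeneity for real scalars only; for complex ones it comes from
  the inner product through \<open>cinner_self\<close>.\<close>

lemma norm_scaleC: "norm (a *\<^sub>C x) = norm a * norm (x :: 'a::complex_inner)"
proof -
  have "cinner (a *\<^sub>C x) (a *\<^sub>C x) = complex_of_real ((norm a * norm x)\<^sup>2)"
    by (simp add: cinner_scaleC_left cinner_scaleC_right cinner_self[of x] power_mult_distrib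
        complex_norm_square mult_ac del: of_real_power)
  then have "(norm (a *\<^sub>C x))\<^sup>2 = (norm a * norm x)\<^sup>2"
    unfolding cinner_self of_real_eq_iff .
  then show ?thesis
    by simp
qed

lemma bounded_linear_cinner_left: "bounded_linear (\<lambda>x. cinner x y)"
  by (rule bounded_linear_intro[where K = "norm y"])
    (simp_all add: cinner_add_left scaleR_scaleC cinner_scaleC_left norm_cinner_le scaleR_conv_of_real)

lemma bounded_clinear_imp_bounded_linear:
  assumes "bounded_clinear T"
  shows "bounded_linear T"
proof -
  obtain C where T: "clinear T" and C: "\<And>x. norm (T x) \<le> C * norm x"
    using assms unfolding bounded_clinear_def by blast
  interpret Vector_Spaces.linear scaleC scaleC T by (fact T)
  show ?thesis
    by (rule bounded_linear_intro[where K = C])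
      (use C in \<open>simp_all add: add scale scaleR_scaleC mult.commute\<close>)
qed

subsection \<open>Bessel systems and complete systems\<close>

text \<open>Stated on finite partial sums with one constant for all \<open>F\<close> and
  \<open>f\<close>, so that summability is a consequence and not a prerequisite.\<close>

definition bessel :: "'i set \<Rightarrow> ('i \<Rightarrow> 'a::complex_inner) \<Rightarrow> bool"
  where "bessel I w \<longleftrightarrow>
    (\<exists>C. \<forall>F f. finite F \<longrightarrow> F \<subseteq> I \<longrightarrow> (\<Sum>\<xi>\<in>F. (norm (cinner f (w \<xi>)))\<^sup>2) \<le> C * (norm f)\<^sup>2)"

definition complete_system :: "'i set \<Rightarrow> ('i \<Rightarrow> 'a::complex_inner) \<Rightarrow> bool"
  where "complete_system I w \<longleftrightarrow> (\<forall>f. (\<forall>\<xi>\<in>I. cinner f (w \<xi>) = 0) \<longrightarrow> f = 0)"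

lemma complete_system_eqI:
  assumes "complete_system I w" and "\<And>\<xi>. \<xi> \<in> I \<Longrightarrow> cinner f (w \<xi>) = cinner g (w \<xi>)"
  shows "f = g"
proof -
  have "\<forall>\<xi>\<in>I. cinner (f - g) (w \<xi>) = 0"
    using assms(2) by (simp add: cinner_diff_left)
  then have "f - g = 0"
    using assms(1) unfolding complete_system_def by blast
  then show ?thesis
    by simp
qed

text \<open>Duality: synthesis from coefficients is adjoint to taking coefficients, so a bound on
  one bounds the other. Synthesizing the coefficients of \<open>f\<close> itself gives
  \<open>g\<close> with \<open>cinner g f = s\<close>, and Cauchy-Schwarz bounds \<open>s\<close>
  squared by \<open>C * s\<close> times the squared norm of \<open>f\<close>.\<close>

lemma besselI_synthesis:
  assumes C: "0 \<le> C" and synthesis: "\<And>F c. finite F \<Longrightarrow> F \<subseteq> I \<Longrightarrow>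
    (norm (\<Sum>\<xi>\<in>F. c \<xi> *\<^sub>C w \<xi>))\<^sup>2 \<le> C * (\<Sum>\<xi>\<in>F. (norm (c \<xi>))\<^sup>2)"
  shows "bessel I w"
  unfolding bessel_def
proof (intro exI[of _ C] allI impI)
  fix F f assume F: "finite F" "F \<subseteq> I"
  define s where "s = (\<Sum>\<xi>\<in>F. (norm (cinner f (w \<xi>)))\<^sup>2)"
  define g where "g = (\<Sum>\<xi>\<in>F. cinner f (w \<xi>) *\<^sub>C w \<xi>)"
  have s0: "s \<ge> 0"
    unfolding s_def by (simp add: sum_nonneg)
  have "cinner g f = complex_of_real s"
    by (simp add: g_def s_def cinner_sum_left cinner_scaleC_left cinner_mult_commute)
  then have "s \<le> norm g * norm f"
    using norm_cinner_le[of g f] s0 by simp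
  then have "s\<^sup>2 \<le> (norm g)\<^sup>2 * (norm f)\<^sup>2"
    using power_mono[OF _ s0, of "norm g * norm f" 2] by (simp add: power_mult_distrib)
  also have "(norm g)\<^sup>2 \<le> C * s"
    unfolding g_def s_def by (rule synthesis[OF F])
  then have "(norm g)\<^sup>2 * (norm f)\<^sup>2 \<le> C * s * (norm f)\<^sup>2"
    by (rule mult_right_mono) simp
  finally have le: "s * s \<le> s * (C * (norm f)\<^sup>2)"
    by (simp add: power2_eq_square mult_ac)
  show "(\<Sum>\<xi>\<in>F. (norm (cinner f (w \<xi>)))\<^sup>2) \<le> C * (norm f)\<^sup>2"
    unfolding s_def[symmetric]
    \<comment> \<open>For positive \<open>s\<close> one factor cancels; for \<open>s = 0\<close> the
      claim is nonnegativity of the right side, which uses \<open>0 \<le> C\<close>.\<close>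
    using le s0 C by (cases "s = 0") simp_all
qed

text \<open>Testing the Bessel inequality on the one-element set of \<xi> with
  \<open>f = w \<xi>\<close> compares a fourth power of the norm with \<open>C\<close> times its
  square.\<close>

lemma bessel_bounded:
  assumes "bessel I w"
  obtains B where "\<And>\<xi>. \<xi> \<in> I \<Longrightarrow> norm (w \<xi>) \<le> B"
proof -
  obtain C where C: "\<And>F f. finite F \<Longrightarrow> F \<subseteq> I \<Longrightarrow>
      (\<Sum>\<xi>\<in>F. (norm (cinner f (w \<xi>)))\<^sup>2) \<le> C * (norm f)\<^sup>2"
    using assms unfolding bessel_def by blast
  have "norm (w \<xi>) \<le> sqrt \<bar>C\<bar>" if "\<xi> \<in> I" for \<xi>
  proof (cases "w \<xi> = 0")
    case False
    have "(norm (w \<xi>))\<^sup>2 * (norm (w \<xi>))\<^sup>2 \<le> C * (norm (w \<xi>))\<^sup>2"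
      using C[of "{\<xi>}" "w \<xi>"] that by (simp add: cinner_self norm_power flip: power2_eq_square)
    then have "(norm (w \<xi>))\<^sup>2 \<le> C"
      using False by (subst (asm) mult_le_cancel_right_pos) simp_all
    then have "(norm (w \<xi>))\<^sup>2 \<le> \<bar>C\<bar>"
      by simp
    then show ?thesis
      by (rule real_le_rsqrt)
  qed simp
  then show ?thesis
    by (rule that)
qed

text \<open>The hypothesis says that \<open>w\<close> is the image of \<open>e\<close> under the
  adjoint of \<open>S\<close>; no adjoint has to be constructed.\<close>

lemma bessel_of_cinner_eq:
  assumes "bessel I e" and "bounded_clinear S"
    and w: "\<And>x \<xi>. \<xi> \<in> I \<Longrightarrow> cinner x (w \<xi>) = cinner (S x) (e \<xi>)"
  shows "bessel I w"
proof -
  obtain D where D: "\<And>F f. finite F \<Longrightarrow> F \<subseteq> I \<Longrightarrow>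
      (\<Sum>\<xi>\<in>F. (norm (cinner f (e \<xi>)))\<^sup>2) \<le> D * (norm f)\<^sup>2"
    using assms(1) unfolding bessel_def by blast
  obtain C where C: "\<And>x. norm (S x) \<le> C * norm x"
    using assms(2) unfolding bounded_clinear_def by blast
  show ?thesis
    unfolding bessel_def
  \<comment> \<open>The absolute value appears because the sign of a Bessel constant is not fixed by
    the definition.\<close>
  proof (intro exI[of _ "\<bar>D\<bar> * C\<^sup>2"] allI impI)
    fix F f assume F: "finite F" "F \<subseteq> I"
    have "(\<Sum>\<xi>\<in>F. (norm (cinner f (w \<xi>)))\<^sup>2) = (\<Sum>\<xi>\<in>F. (norm (cinner (S f) (e \<xi>)))\<^sup>2)"
      using F(2) w by (intro sum.cong refl) auto
    also have "\<dots> \<le> D * (norm (S f))\<^sup>2"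
      by (rule D[OF F])
    also have "\<dots> \<le> \<bar>D\<bar> * (C * norm f)\<^sup>2"
      by (intro mult_mono power_mono C) simp_all
    finally show "(\<Sum>\<xi>\<in>F. (norm (cinner f (w \<xi>)))\<^sup>2) \<le> \<bar>D\<bar> * C\<^sup>2 * (norm f)\<^sup>2"
      by (simp add: power_mult_distrib mult.assoc)
  qed
qed

text \<open>The \<open>u \<xi>\<close> are uniformly bounded, and a product of two square-summable
  coefficient families is dominated by the sum of their squares. The series thus converges
  absolutely, hence converges by completeness.\<close>

lemma convolution_summable:
  fixes u v :: "'i \<Rightarrow> 'a::complex_hilbert"
  assumes "bessel I u" and "bessel I v"
  shows "(\<lambda>\<xi>. (cinner f (v \<xi>) * cinner g (v \<xi>)) *\<^sub>C u \<xi>) summable_on I"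
proof -
  obtain B where B: "\<And>\<xi>. \<xi> \<in> I \<Longrightarrow> norm (u \<xi>) \<le> B"
    using bessel_bounded[OF assms(1)] by blast
  have square_summable: "(\<lambda>\<xi>. (norm (cinner h (v \<xi>)))\<^sup>2) summable_on I" for h
  proof (rule nonneg_bdd_above_summable_on)
    obtain C where "\<And>F f. finite F \<Longrightarrow> F \<subseteq> I \<Longrightarrow>
        (\<Sum>\<xi>\<in>F. (norm (cinner f (v \<xi>)))\<^sup>2) \<le> C * (norm f)\<^sup>2"
      using assms(2) unfolding bessel_def by blast
    then show "bdd_above (sum (\<lambda>\<xi>. (norm (cinner h (v \<xi>)))\<^sup>2) ` {F. F \<subseteq> I \<and> finite F})"
      by (intro bdd_aboveI2) auto
  qed simp
  have "(\<lambda>\<xi>. B * ((norm (cinner f (v \<xi>)))\<^sup>2 + (norm (cinner g (v \<xi>)))\<^sup>2)) summable_on I"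
    by (intro summable_on_cmult_right summable_on_add square_summable)
  moreover have "norm ((cinner f (v \<xi>) * cinner g (v \<xi>)) *\<^sub>C u \<xi>)
      \<le> B * ((norm (cinner f (v \<xi>)))\<^sup>2 + (norm (cinner g (v \<xi>)))\<^sup>2)" if "\<xi> \<in> I" for \<xi>
  proof -
    have "norm (cinner f (v \<xi>)) * norm (cinner g (v \<xi>))
        \<le> (norm (cinner f (v \<xi>)))\<^sup>2 + (norm (cinner g (v \<xi>)))\<^sup>2"
      using sum_squares_bound[of "norm (cinner f (v \<xi>))" "norm (cinner g (v \<xi>))"]
        mult_nonneg_nonneg[OF norm_ge_zero norm_ge_zero, of "cinner f (v \<xi>)" "cinner g (v \<xi>)"]
      by linarith
    from mult_mono[OF B[OF that] this] show ?thesis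
      \<comment> \<open>\<open>B\<close> is nonnegative because it bounds the norm at the given
        index.\<close>
      using order_trans[OF norm_ge_zero B[OF that]] by (simp add: norm_scaleC norm_mult mult_ac)
  qed
  ultimately have "(\<lambda>\<xi>. norm ((cinner f (v \<xi>) * cinner g (v \<xi>)) *\<^sub>C u \<xi>)) summable_on I"
    by (rule Infinite_Sum.abs_summable_on_comparison_test')
  then show ?thesis
    by (rule abs_summable_summable)
qed

text \<open>Pairing with \<open>v \<eta>\<close> is continuous and passes through the sum;
  biorthogonality kills every term except the one at \<eta>.\<close>

lemma fourier_transform_convolution:
  fixes u v :: "'i \<Rightarrow> 'a::complex_hilbert"
  assumes bessel: "bessel I u" "bessel I v"
    and biorth: "biorthogonal I u v" and \<eta>: "\<eta> \<in> I"
  shows "fourier_transform v (convolution I u v f g) \<eta>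
    = fourier_transform v f \<eta> * fourier_transform v g \<eta>"
proof -
  let ?c = "\<lambda>\<xi>. cinner f (v \<xi>) * cinner g (v \<xi>)"
  have "((\<lambda>\<xi>. ?c \<xi> *\<^sub>C u \<xi>) has_sum convolution I u v f g) I"
    unfolding convolution_def using convolution_summable[OF bessel] by (rule has_sum_infsum)
  then have "((\<lambda>\<xi>. cinner (?c \<xi> *\<^sub>C u \<xi>) (v \<eta>)) has_sum cinner (convolution I u v f g) (v \<eta>)) I"
    by (rule has_sum_bounded_linear[OF bounded_linear_cinner_left])
  moreover have "((\<lambda>\<xi>. cinner (?c \<xi> *\<^sub>C u \<xi>) (v \<eta>)) has_sum ?c \<eta>) I
      \<longleftrightarrow> ((\<lambda>\<xi>. ?c \<xi>) has_sum ?c \<eta>) {\<eta>}"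
    using biorth \<eta>
    by (intro has_sum_cong_neutral) (auto simp: biorthogonal_def cinner_scaleC_left)
  moreover have "((\<lambda>\<xi>. ?c \<xi>) has_sum ?c \<eta>) {\<eta>}"
    by (rule has_sum_finiteI) simp_all
  ultimately show ?thesis
    unfolding fourier_transform_def using has_sum_unique by blast
qed

subsection \<open>Riesz bases\<close>

text \<open>The kernel is a closed complex subspace containing the basis, whose span is dense.
  Complex homogeneity is a separate assumption since \<open>bounded_linear\<close> is real linearity
  only.\<close>

lemma orthonormal_basis_functional_zero:
  fixes \<phi> :: "'a::complex_inner \<Rightarrow> complex"
  assumes e: "orthonormal_basis I e"
    and \<phi>: "bounded_linear \<phi>" and \<phi>_scaleC: "\<And>a x. \<phi> (a *\<^sub>C x) = a * \<phi> x"
    and \<phi>_basis: "\<And>\<xi>. \<xi> \<in> I \<Longrightarrow> \<phi> (e \<xi>) = 0"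
  shows "\<phi> x = 0"
proof -
  interpret bounded_linear \<phi> by (fact \<phi>)
  have "scaleC.subspace {x. \<phi> x = 0}"
    by (rule scaleC.subspaceI) (simp_all add: add \<phi>_scaleC)
  then have "cspan (e ` I) \<subseteq> {x. \<phi> x = 0}"
    using \<phi>_basis by (intro scaleC.span_minimal) auto
  moreover have "closed {x. \<phi> x = 0}"
    by (intro closed_Collect_eq linear_continuous_on \<phi> continuous_on_const)
  ultimately have "closure (cspan (e ` I)) \<subseteq> {x. \<phi> x = 0}"
    by (rule closure_minimal)
  then show ?thesis
    using e unfolding orthonormal_basis_def by auto
qed

lemma norm_orthonormal_sum:
  assumes orth: "biorthogonal I e e" and F: "finite F" "F \<subseteq> I"
  shows "(norm (\<Sum>\<xi>\<in>F. c \<xi> *\<^sub>C e \<xi>))\<^sup>2 = (\<Sum>\<xi>\<in>F. (norm (c \<xi>))\<^sup>2)"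
proof -
  let ?x = "\<Sum>\<xi>\<in>F. c \<xi> *\<^sub>C e \<xi>"
  have "cinner ?x ?x = (\<Sum>\<xi>\<in>F. \<Sum>\<eta>\<in>F. c \<xi> * (cnj (c \<eta>) * cinner (e \<xi>) (e \<eta>)))"
    by (simp only: cinner_sum_left)
      (simp add: cinner_sum_right cinner_scaleC_left cinner_scaleC_right mult.left_commute)
  also have "\<dots> = (\<Sum>\<xi>\<in>F. \<Sum>\<eta>\<in>F. if \<xi> = \<eta> then c \<xi> * cnj (c \<eta>) else 0)"
    using orth F(2) unfolding biorthogonal_def by (intro sum.cong refl) (auto simp: subset_iff)
  also have "\<dots> = complex_of_real (\<Sum>\<xi>\<in>F. (norm (c \<xi>))\<^sup>2)"
    using F(1) by (simp add: complex_norm_square del: of_real_power)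
  finally show ?thesis
    unfolding cinner_self of_real_eq_iff .
qed

text \<open>Synthesis with \<open>w\<close> is \<open>T\<close> after synthesis with
  \<open>e\<close>, and the latter preserves the norm of the coefficients by Pythagoras.\<close>

lemma bessel_image_orthonormal:
  assumes orth: "biorthogonal I e e" and T: "bounded_clinear T"
    and w: "\<And>\<xi>. \<xi> \<in> I \<Longrightarrow> w \<xi> = T (e \<xi>)"
  shows "bessel I w"
proof -
  obtain C where C: "\<And>x. norm (T x) \<le> C * norm x"
    using T unfolding bounded_clinear_def by blast
  have "clinear T"
    using T unfolding bounded_clinear_def by blast
  then interpret T: Vector_Spaces.linear scaleC scaleC T .
  show ?thesis
  proof (rule besselI_synthesis)
    fix F c assume F: "finite F" "F \<subseteq> I"
    let ?x = "\<Sum>\<xi>\<in>F. c \<xi> *\<^sub>C e \<xi>"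
    have "(\<Sum>\<xi>\<in>F. c \<xi> *\<^sub>C w \<xi>) = T ?x"
      unfolding T.sum T.scale using F(2) w by (intro sum.cong refl) auto
    then have "(norm (\<Sum>\<xi>\<in>F. c \<xi> *\<^sub>C w \<xi>))\<^sup>2 \<le> (C * norm ?x)\<^sup>2"
      using C[of ?x] by (simp add: power_mono)
    then show "(norm (\<Sum>\<xi>\<in>F. c \<xi> *\<^sub>C w \<xi>))\<^sup>2 \<le> C\<^sup>2 * (\<Sum>\<xi>\<in>F. (norm (c \<xi>))\<^sup>2)"
      by (simp add: power_mult_distrib norm_orthonormal_sum[OF orth F])
  qed simp
qed

text \<open>Collects, symmetrically in \<open>u\<close> and \<open>v\<close>, what the convolution
  lemmas take from the Riesz basis. The facts about \<open>v\<close> come from reading its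
  coefficients as those of \<open>inv T x\<close> against \<open>e\<close>.\<close>

lemma riesz_basis_bessel_complete:
  assumes "riesz_basis I u" and biorth: "biorthogonal I u v"
  shows "bessel I u" "bessel I v" "complete_system I u" "complete_system I v"
proof -
  obtain e :: "'a \<Rightarrow> 'b" and T where e: "orthonormal_basis I e" and T: "bounded_clinear T"
    and bij: "bij T" and S: "bounded_clinear (inv T)" and u: "\<And>\<xi>. \<xi> \<in> I \<Longrightarrow> u \<xi> = T (e \<xi>)"
    using assms(1) unfolding riesz_basis_def by blast
  have orth: "biorthogonal I e e"
    using e unfolding orthonormal_basis_def by blast
  have "clinear T"
    using T unfolding bounded_clinear_def by blast
  then interpret T: Vector_Spaces.linear scaleC scaleC T .
  note blT = bounded_clinear_imp_bounded_linear[OF T]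
  note bounded_linear_cinner_T = bounded_linear_compose[OF bounded_linear_cinner_left blT, unfolded o_def]
  have inv_T: "T (inv T x) = x" for x
    using bij by (simp add: bij_is_surj surj_f_inv_f)
  \<comment> \<open>On a basis vector \<open>e \<eta>\<close> both terms are the same Kronecker
    delta, so the difference vanishes on the basis.\<close>
  have "cinner (T x) (v \<xi>) - cinner x (e \<xi>) = 0" if "\<xi> \<in> I" for x \<xi>
    by (rule orthonormal_basis_functional_zero[OF e])
      (use that biorth orth u in \<open>auto simp: T.scale cinner_scaleC_left right_diff_distrib biorthogonal_def
        intro!: bounded_linear_sub bounded_linear_cinner_T bounded_linear_cinner_left\<close>)
  then have v: "cinner x (v \<xi>) = cinner (inv T x) (e \<xi>)" if "\<xi> \<in> I" for x \<xi>
    using that inv_T by (metis eq_iff_diff_eq_0)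
  have zero_left: "x = 0" if "\<And>y. cinner y x = 0" for x :: 'b
    using cinner_self[of x] that by simp
  show "bessel I u"
    by (rule bessel_image_orthonormal[OF orth T u])
  \<comment> \<open>Bessel's inequality for \<open>e\<close> itself: \<open>e\<close> is its own
    image under the identity.\<close>
  have "bounded_clinear (\<lambda>x::'b. x)"
    unfolding bounded_clinear_def
    by (auto intro!: exI[of _ 1] scaleC.linear_ident)
  then have "bessel I e"
    by (rule bessel_image_orthonormal[OF orth]) simp
  then show "bessel I v"
    by (rule bessel_of_cinner_eq[OF _ S v])
  show "complete_system I u"
    unfolding complete_system_def
  proof (intro allI impI)
    fix f assume f: "\<forall>\<xi>\<in>I. cinner f (u \<xi>) = 0"
    \<comment> \<open>The arguments are swapped because the density argument needs a functional
      linear in the varying vector; surjectivity of \<open>T\<close> then makes \<open>f\<close>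
      orthogonal to every vector.\<close>
    have u_f: "cinner (u \<xi>) f = 0" if "\<xi> \<in> I" for \<xi>
      using f that cinner_commute[of "u \<xi>" f] by simp
    have "cinner (T x) f = 0" for x
      by (rule orthonormal_basis_functional_zero[OF e bounded_linear_cinner_T])
        (simp_all add: T.scale cinner_scaleC_left u_f flip: u)
    then have "cinner y f = 0" for y
      by (metis inv_T)
    then show "f = 0"
      by (rule zero_left)
  qed
  show "complete_system I v"
    unfolding complete_system_def
  proof (intro allI impI)
    fix f assume "\<forall>\<xi>\<in>I. cinner f (v \<xi>) = 0"
    then have f: "cinner (inv T f) (e \<xi>) = 0" if "\<xi> \<in> I" for \<xi>
      using that v by simp
    have e_f: "cinner (e \<xi>) (inv T f) = 0" if "\<xi> \<in> I" for \<xi>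
      using f[OF that] cinner_commute[of "e \<xi>" "inv T f"] by simp
    have "cinner y (inv T f) = 0" for y
      by (rule orthonormal_basis_functional_zero[OF e bounded_linear_cinner_left])
        (simp_all add: cinner_scaleC_left e_f)
    then have "inv T f = 0"
      by (rule zero_left)
    then show "f = 0"
      using inv_T[of f] by simp
  qed
qed

section \<open>Algebraic laws and uniqueness of the convolutions\<close>

lemma biorthogonal_sym: "biorthogonal I u v \<Longrightarrow> biorthogonal I v u"
  unfolding biorthogonal_def by (metis cinner_commute complex_cnj_one complex_cnj_zero)

lemma convolution_commute: "convolution I u v f g = convolution I u v g f"
  unfolding convolution_def by (simp add: mult.commute)

lemma fourier_transform_eqI:
  assumes "complete_system I w" and "\<And>\<xi>. \<xi> \<in> I \<Longrightarrow> fourier_transform w f \<xi> = fourier_transform w g \<xi>"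
  shows "f = g"
  using assms unfolding fourier_transform_def by (rule complete_system_eqI)

text \<open>Both sides have the product of the three transforms as transform, and completeness of
  \<open>v\<close> makes the transform injective.\<close>

lemma convolution_assoc:
  fixes u v :: "'i \<Rightarrow> 'a::complex_hilbert"
  assumes "bessel I u" "bessel I v" "biorthogonal I u v" and "complete_system I v"
  shows "convolution I u v (convolution I u v f g) h = convolution I u v f (convolution I u v g h)"
  by (rule fourier_transform_eqI[OF assms(4)])
    (simp add: fourier_transform_convolution[OF assms(1-3)] mult.assoc)

lemma convolution_unique:
  fixes u v :: "'i \<Rightarrow> 'a::complex_hilbert"
  assumes "bessel I u" "bessel I v" "biorthogonal I u v" and "complete_system I v"
    and "\<forall>f g. \<forall>\<xi>\<in>I. fourier_transform v (K f g) \<xi> = fourier_transform v f \<xi> * fourier_transform v g \<xi>"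
  shows "K f g = convolution I u v f g"
  by (rule fourier_transform_eqI[OF assms(4)])
    (simp add: fourier_transform_convolution[OF assms(1-3)] assms(5))

theorem theorem2p2:
  fixes I :: "'i set" and u v :: "'i \<Rightarrow> 'h::complex_hilbert"
  assumes separable: "separable_space (euclidean :: 'h topology)"
    and countable: "countable I"
    and riesz: "riesz_basis I u"
    and biorth: "biorthogonal I u v"
  shows
    "(\<forall>f g. \<forall>\<xi>\<in>I. fourier_transform v (convolution I u v f g) \<xi>
        = fourier_transform v f \<xi> * fourier_transform v g \<xi>) \<and>
     (\<forall>h j. \<forall>\<xi>\<in>I. fourier_transform u (convolution I v u h j) \<xi>
        = fourier_transform u h \<xi> * fourier_transform u j \<xi>) \<and>
     (\<forall>f g. convolution I u v f g = convolution I u v g f) \<and>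
     (\<forall>f g h. convolution I u v (convolution I u v f g) h
        = convolution I u v f (convolution I u v g h)) \<and>
     (\<forall>f g. convolution I v u f g = convolution I v u g f) \<and>
     (\<forall>f g h. convolution I v u (convolution I v u f g) h
        = convolution I v u f (convolution I v u g h)) \<and>
     (\<forall>K :: 'h \<Rightarrow> 'h \<Rightarrow> 'h. cbilinear K \<longrightarrow>
        (\<forall>f g. \<forall>\<xi>\<in>I. fourier_transform v (K f g) \<xi>
           = fourier_transform v f \<xi> * fourier_transform v g \<xi>) \<longrightarrow>
        (\<forall>f g. K f g = convolution I u v f g)) \<and>
     (\<forall>K :: 'h \<Rightarrow> 'h \<Rightarrow> 'h. cbilinear K \<longrightarrow>
        (\<forall>f g. \<forall>\<xi>\<in>I. fourier_transform u (K f g) \<xi>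
           = fourier_transform u f \<xi> * fourier_transform u g \<xi>) \<longrightarrow>
        (\<forall>f g. K f g = convolution I v u f g))"
proof -
  note uv = riesz_basis_bessel_complete[OF riesz biorth]
  \<comment> \<open>\<open>U\<close> and \<open>V\<close> are the same hypotheses with the roles of
    \<open>u\<close> and \<open>v\<close> exchanged. Each is paired below with completeness of the
    system defining its transform: \<open>uv(4)\<close> for \<open>v\<close>, \<open>uv(3)\<close>
    for \<open>u\<close>.\<close>
  note U = uv(1,2) biorth and V = uv(2,1) biorthogonal_sym[OF biorth]
  show ?thesis
  proof (intro conjI allI ballI impI)
    show "convolution I u v f g = convolution I u v g f" "convolution I v u f g = convolution I v u g f"
      for f g
      by (rule convolution_commute)+
  qed (rule fourier_transform_convolution[OF U] fourier_transform_convolution[OF V]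
      convolution_assoc[OF U uv(4)] convolution_assoc[OF V uv(3)]
      convolution_unique[OF U uv(4)] convolution_unique[OF V uv(3)]; assumption)+
qed

end
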